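(* Let $\mathrm{C}$ be a nonsingular $sN\times sN$ matrix. Let $V_h=\sum_{i=1}^{N_S}V_i$ be a (not necessarily direct) decomposition of the $N$-dimensional space $V_h$ into subspaces, with prolongation and restriction matrices $P_i$, $R_i$ between $V_i$ and $V_h$, and let $\mathrm{P}_i=I_s\otimes P_i$, $\mathrm{R}_i=I_s\otimes R_i$. Assume that the stage-coupled additive Schwarz preconditioner $\mathrm{W}$ is well defined by $$\mathrm{W}^{-1}=\sum_{i=1}^{N_S}\mathrm{P}_i\left(\mathrm{R}_i\,\mathrm{C}\,\mathrm{P}_i\right)^{-1}\mathrm{R}_i ,$$ i.e. each local matrix $\mathrm{R}_i\mathrm{C}\mathrm{P}_i$ is nonsingular and the sum on the right-hand side is nonsingular. If $\mathrm{C}$ is monolithic with respect to $\mathrm{X}=X\otimes I_N$, then so is $\mathrm{W}$.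
   Context: $X\in\mathbb{C}^{s\times s}$ is an invertible matrix, namely the eigenvector matrix in $A=X\Lambda X^{-1}$, where the Butcher matrix $A\in\mathbb{R}^{s\times s}$ of an $s$-stage Runge-Kutta method is assumed diagonalizable; $\otimes$ is the Kronecker product. $V_h$ is a finite-dimensional (finite element) space with a basis, $N=\dim V_h$. Each $V_i\subset V_h$ is given a basis, $n_i=\dim V_i$; $P_i$ ($N\times n_i$) is the matrix of the inclusion $V_i\to V_h$ and $R_i$ ($n_i\times N$) is a restriction matrix. The matrices $\mathrm{P}_i$, $\mathrm{R}_i$ act between the $s$-fold product spaces $\mathbf{V}_i=\prod_{j=1}^sV_i$ and $\mathbf{V}_h=\prod_{j=1}^sV_h$, componentwise. Definition (monolithic). An $sN\times sN$ matrix $\mathrm{Y}$ is monolithic with respect to $\mathrm{X}=X\otimes I_N$ if there exist $N\times N$ (complex) matrices $Y_1,\dots,Y_s$ with $\mathrm{X}^{-1}\mathrm{Y}\mathrm{X}=\mathrm{diag}_{1\le i\le s}Y_i$ (block diagonal). *)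

theory Defs
  imports Complex_Main "Jordan_Normal_Form.Gauss_Jordan_Elimination"
begin

text \<open>Only meaningful for invertible matrices, where \<^const>\<open>mat_inverse\<close> is not \<^const>\<open>None\<close>.\<close>

definition mat_inv :: "'a::field mat \<Rightarrow> 'a mat" where
  "mat_inv A = the (mat_inverse A)"

definition kronecker_mat :: "'a::times mat \<Rightarrow> 'a mat \<Rightarrow> 'a mat" (infixl "\<otimes>\<^sub>K" 70) where
  "A \<otimes>\<^sub>K B = mat (dim_row A * dim_row B) (dim_col A * dim_col B)
     (\<lambda>(i, j). A $$ (i div dim_row B, j div dim_col B) * B $$ (i mod dim_row B, j mod dim_col B))"

definition monolithic :: "nat \<Rightarrow> nat \<Rightarrow> complex mat \<Rightarrow> complex mat \<Rightarrow> bool" where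
  "monolithic s N X Y \<longleftrightarrow> Y \<in> carrier_mat (s * N) (s * N) \<and>
     (\<exists>Ys. length Ys = s \<and> set Ys \<subseteq> carrier_mat N N \<and>
        mat_inv (X \<otimes>\<^sub>K 1\<^sub>m N) * Y * (X \<otimes>\<^sub>K 1\<^sub>m N) = diag_block_mat Ys)"

context vector_space
begin

definition ordered_basis :: "'b list \<Rightarrow> 'b set \<Rightarrow> bool" where
  "ordered_basis bs V \<longleftrightarrow> distinct bs \<and> independent (set bs) \<and> span (set bs) = V"

text \<open>Matrix of the inclusion \<open>span (set cs) \<subseteq> span (set bs)\<close> in the ordered bases \<open>cs\<close> and
  \<open>bs\<close>: its column \<open>j\<close> holds the \<open>bs\<close>-coordinates of \<open>cs ! j\<close>.\<close>

definition inclusion_mat :: "'b list \<Rightarrow> 'b list \<Rightarrow> 'a mat" where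
  "inclusion_mat bs cs =
     mat (length bs) (length cs) (\<lambda>(k, j). representation (set bs) (cs ! j) (bs ! k))"

end

definition local_mat ::
  "nat \<Rightarrow> complex mat \<Rightarrow> complex mat \<Rightarrow> complex mat \<Rightarrow> complex mat" where
  "local_mat s C P R = (1\<^sub>m s \<otimes>\<^sub>K R) * C * (1\<^sub>m s \<otimes>\<^sub>K P)"

text \<open>The sum is taken in the additive group of \<open>sN \<times> sN\<close> matrices, since the type of
  matrices of arbitrary dimensions has no common zero.\<close>

definition schwarz_sum ::
  "nat \<Rightarrow> nat \<Rightarrow> nat \<Rightarrow> complex mat \<Rightarrow> (nat \<Rightarrow> complex mat) \<Rightarrow> (nat \<Rightarrow> complex mat) \<Rightarrow> complex mat"
where
  "schwarz_sum s N NS C P R =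
     finsum (module_mat TYPE(complex) (s * N) (s * N))
       (\<lambda>i. (1\<^sub>m s \<otimes>\<^sub>K P i) * mat_inv (local_mat s C (P i) (R i)) * (1\<^sub>m s \<otimes>\<^sub>K R i))
       {..<NS}"

end

theory Submission
  imports Defs
begin

text \<open>Let \<open>D = diag(0, \<dots>, s - 1)\<close> and \<open>B = X D X\<^sup>-\<^sup>1\<close>. Since the diagonal entries of \<open>D\<close> are distinct,
  a matrix is block diagonal iff it commutes with \<open>D \<otimes> I\<^sub>N\<close>; conjugating with \<open>X \<otimes> I\<^sub>N\<close>, it is
  monolithic iff it commutes with \<open>B \<otimes> I\<^sub>N\<close>. The matrices \<open>I\<^sub>s \<otimes> P\<^sub>i\<close> and \<open>I\<^sub>s \<otimes> R\<^sub>i\<close> intertwine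
  \<open>B \<otimes> I\<^sub>N\<close> with \<open>B \<otimes> I\<^sub>n\<close>, where \<open>n = n\<^sub>i\<close>, and intertwining relations survive products, inverses
  and sums, so the Schwarz sum and its inverse \<open>W\<close> commute with \<open>B \<otimes> I\<^sub>N\<close> as well.\<close>

section \<open>Inverses, intertwining and conjugation\<close>

text \<open>A two-sided inverse makes \<open>A\<close> a unit of the ring of n x n matrices, so
  Gauss-Jordan elimination cannot return \<open>None\<close>, and the correctness of
  \<open>mat_inverse\<close> applies to its result.\<close>

lemma mat_inv_properties:
  assumes A: "A \<in> carrier_mat n n" and "invertible_mat A"
  shows "A * mat_inv A = 1\<^sub>m n" "mat_inv A * A = 1\<^sub>m n" "mat_inv A \<in> carrier_mat n n"
proof -
  obtain B where AB: "A * B = 1\<^sub>m n" and BA: "B * A = 1\<^sub>m (dim_row B)"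
    using assms unfolding invertible_mat_def inverts_mat_def by auto
  \<comment> \<open>Invertibility alone does not fix the shape of \<open>B\<close>: the columns of
    \<open>A * B\<close> are counted by \<open>B\<close>, and those of \<open>B * A\<close> by
    \<open>A\<close>, which gives the rows of \<open>B\<close>.\<close>
  have "dim_col B = n" "dim_row B = n"
    using AB BA A by (metis index_mult_mat(3) index_one_mat(3) carrier_matD(2))+
  then have B: "B \<in> carrier_mat n n" by auto
  have "A \<in> Units (ring_mat TYPE('a) n ())"
    using A B AB BA unfolding Units_def by (auto simp: ring_mat_simps intro!: bexI[of _ B])
  then obtain C where C: "mat_inverse A = Some C"
    using mat_inverse(1)[OF A, of "()"] by (cases "mat_inverse A") auto
  show "A * mat_inv A = 1\<^sub>m n" "mat_inv A * A = 1\<^sub>m n" "mat_inv A \<in> carrier_mat n n"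
    using mat_inverse(2)[OF A C] C by (auto simp: mat_inv_def)
qed

lemma mat_inv_eqI:
  assumes A: "A \<in> carrier_mat n n" and B: "B \<in> carrier_mat n n"
    and AB: "A * B = 1\<^sub>m n" and BA: "B * A = 1\<^sub>m n"
  shows "mat_inv A = B"
proof -
  have "invertible_mat A"
    using assms unfolding invertible_mat_def inverts_mat_def by auto
  note inv = mat_inv_properties[OF A this]
  have "(mat_inv A * A) * B = mat_inv A * (A * B)" using inv A B by (intro assoc_mult_mat)
  then show ?thesis using inv B AB by simp
qed

text \<open>The square matrix is moved through one factor at a time. The factors may be rectangular,
  so a chain of relations can lead from the global size to a local one and back.\<close>

lemma intertwine_mult:
  assumes "A \<in> carrier_mat l l" "B \<in> carrier_mat m m" "C \<in> carrier_mat n n"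
    and "M \<in> carrier_mat l m" "M' \<in> carrier_mat m n"
    and "A * M = M * B" "B * M' = M' * C"
  shows "A * (M * M') = (M * M') * C"
proof -
  have "A * (M * M') = (A * M) * M'" using assms(1,4,5) by (simp add: assoc_mult_mat)
  also have "\<dots> = M * (B * M')" using assms by (simp add: assoc_mult_mat)
  also have "\<dots> = (M * M') * C" using assms by (simp add: assoc_mult_mat)
  finally show ?thesis .
qed

text \<open>Multiply the relation by \<open>M'\<close> on both sides. Keeping \<open>M'\<close>
  free, rather than fixing it as \<open>mat_inv M\<close>, also allows passing from an inverse back
  to the original matrix.\<close>

lemma commute_inverse:
  fixes A M :: "'a::semiring_1 mat"
  assumes A: "A \<in> carrier_mat n n" and M: "M \<in> carrier_mat n n" and M': "M' \<in> carrier_mat n n"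
    and MM': "M * M' = 1\<^sub>m n" and M'M: "M' * M = 1\<^sub>m n" and comm: "A * M = M * A"
  shows "A * M' = M' * A"
proof -
  have "A * M' = (M' * M) * (A * M')" using A M' M'M by simp
  also have "\<dots> = M' * ((M * A) * M')"
    using A M M' by (simp add: assoc_mult_mat[of _ n n _ n _ n] mult_carrier_mat[of _ n n _ n])
  also have "\<dots> = (M' * A) * (M * M')"
    unfolding comm[symmetric]
    using A M M' by (simp add: assoc_mult_mat[of _ n n _ n _ n] mult_carrier_mat[of _ n n _ n])
  finally show ?thesis using A M' MM' by simp
qed

lemma commute_mat_inv:
  assumes "A \<in> carrier_mat n n" "M \<in> carrier_mat n n" "invertible_mat M" "A * M = M * A"
  shows "A * mat_inv M = mat_inv M * A"
  using mat_inv_properties[OF assms(2,3)] by (intro commute_inverse[OF assms(1,2) _ _ _ assms(4)])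

text \<open>Multiplying the first equation by \<open>P\<close> on the left and \<open>Q\<close> on
  the right turns it into the second; multiplying by \<open>Q\<close> and \<open>P\<close> instead
  undoes this.\<close>

lemma commute_conjugate_iff:
  fixes E P Q Y :: "'a::semiring_1 mat"
  assumes E: "E \<in> carrier_mat n n" and P: "P \<in> carrier_mat n n" and Q: "Q \<in> carrier_mat n n"
    and Y: "Y \<in> carrier_mat n n" and PQ: "P * Q = 1\<^sub>m n" and QP: "Q * P = 1\<^sub>m n"
  shows "E * (Q * Y * P) = (Q * Y * P) * E \<longleftrightarrow> (P * E * Q) * Y = Y * (P * E * Q)"
proof -
  note simps = assoc_mult_mat[of _ n n _ n _ n] mult_carrier_mat[of _ n n _ n]
  \<comment> \<open>Cancellation is stated in right-nested form because \<open>simps\<close>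
    reassociates all products to the right.\<close>
  have PQc: "P * (Q * Z) = Z" if "Z \<in> carrier_mat n n" for Z
    using P Q that PQ by (simp flip: assoc_mult_mat[of _ n n _ n _ n])
  have QPc: "Q * (P * Z) = Z" if "Z \<in> carrier_mat n n" for Z
    using P Q that QP by (simp flip: assoc_mult_mat[of _ n n _ n _ n])
  show ?thesis
  proof
    assume "E * (Q * Y * P) = (Q * Y * P) * E"
    then have "P * (E * (Q * Y * P)) * Q = P * ((Q * Y * P) * E) * Q" by simp
    then show "(P * E * Q) * Y = Y * (P * E * Q)"
      using E P Q Y by (simp add: simps PQ PQc)
  next
    assume "(P * E * Q) * Y = Y * (P * E * Q)"
    then have "Q * ((P * E * Q) * Y) * P = Q * (Y * (P * E * Q)) * P" by simp
    then show "E * (Q * Y * P) = (Q * Y * P) * E"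
      using E P Q Y by (simp add: simps QP QPc)
  qed
qed

section \<open>Kronecker products\<close>

lemma kronecker_mat_carrier [simp]:
  "A \<in> carrier_mat a b \<Longrightarrow> B \<in> carrier_mat c d \<Longrightarrow> A \<otimes>\<^sub>K B \<in> carrier_mat (a * c) (b * d)"
  by (auto simp: kronecker_mat_def)

lemma div_mod_less_mult:
  fixes i :: nat
  assumes "i < a * b"
  shows "i div b < a" "i mod b < b"
  using assms by (cases "b = 0"; auto simp: less_mult_imp_div_less)+

lemma index_kronecker_mat:
  assumes "A \<in> carrier_mat a b" "B \<in> carrier_mat c d" "i < a * c" "j < b * d"
  shows "(A \<otimes>\<^sub>K B) $$ (i, j) = A $$ (i div c, j div d) * B $$ (i mod c, j mod d)"
  using assms by (auto simp: kronecker_mat_def)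

text \<open>Quotient and remainder by \<open>d\<close> form a bijection onto the b x d grid, with
  inverse \<open>x * d + y\<close>. It splits the summation index of a product of Kronecker
  products.\<close>

lemma sum_lessThan_mult_div_mod:
  fixes f :: "nat \<Rightarrow> nat \<Rightarrow> 'a::comm_monoid_add"
  shows "(\<Sum>k<b * d. f (k div d) (k mod d)) = (\<Sum>x<b. \<Sum>y<d. f x y)"
proof -
  have "(\<Sum>x<b. \<Sum>y<d. f x y) = (\<Sum>(x, y)\<in>{..<b} \<times> {..<d}. f x y)"
    by (simp add: sum.cartesian_product)
  also have "\<dots> = (\<Sum>k<b * d. f (k div d) (k mod d))"
  proof (rule sum.reindex_bij_witness[of _ "\<lambda>k. (k div d, k mod d)" "\<lambda>(x, y). x * d + y"])
    fix p assume "p \<in> {..<b} \<times> {..<d}"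
    then obtain x y where p: "p = (x, y)" "x < b" "y < d" by auto
    have "x * d + y < Suc x * d" using p by simp
    also have "\<dots> \<le> b * d" using p by (intro mult_right_mono) auto
    finally show "(case p of (x, y) \<Rightarrow> x * d + y) \<in> {..<b * d}" using p by simp
  qed (auto simp: div_mod_less_mult)
  finally show ?thesis by simp
qed

text \<open>The mixed-product rule: once the inner index is split into quotient and remainder, the
  double sum factors into an entry of \<open>A * C\<close> times an entry of
  \<open>B * D\<close>.\<close>

lemma kronecker_mat_mult:
  fixes A B :: "'a::comm_semiring_0 mat"
  assumes A: "A \<in> carrier_mat a b" and B: "B \<in> carrier_mat c d"
    and C: "C \<in> carrier_mat b e" and D: "D \<in> carrier_mat d f"
  shows "(A \<otimes>\<^sub>K B) * (C \<otimes>\<^sub>K D) = (A * C) \<otimes>\<^sub>K (B * D)"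
proof (rule eq_matI)
  have l: "A \<otimes>\<^sub>K B \<in> carrier_mat (a * c) (b * d)" "C \<otimes>\<^sub>K D \<in> carrier_mat (b * d) (e * f)"
    "A * C \<in> carrier_mat a e" "B * D \<in> carrier_mat c f"
    "(A * C) \<otimes>\<^sub>K (B * D) \<in> carrier_mat (a * c) (e * f)"
    using assms by (auto intro!: kronecker_mat_carrier mult_carrier_mat)
  show "dim_row ((A \<otimes>\<^sub>K B) * (C \<otimes>\<^sub>K D)) = dim_row ((A * C) \<otimes>\<^sub>K (B * D))"
    "dim_col ((A \<otimes>\<^sub>K B) * (C \<otimes>\<^sub>K D)) = dim_col ((A * C) \<otimes>\<^sub>K (B * D))"
    by (simp_all only: carrier_matD[OF mult_carrier_mat[OF l(1,2)]] carrier_matD[OF l(5)])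
  fix i j assume "i < dim_row ((A * C) \<otimes>\<^sub>K (B * D))" "j < dim_col ((A * C) \<otimes>\<^sub>K (B * D))"
  then have i: "i < a * c" and j: "j < e * f" by (simp_all only: carrier_matD[OF l(5)])
  note im = div_mod_less_mult[OF i] and jm = div_mod_less_mult[OF j]
  have "((A \<otimes>\<^sub>K B) * (C \<otimes>\<^sub>K D)) $$ (i, j)
      = (\<Sum>k<b * d. (A \<otimes>\<^sub>K B) $$ (i, k) * (C \<otimes>\<^sub>K D) $$ (k, j))"
    using l(1,2) i j by (simp add: scalar_prod_def atLeast0LessThan)
  also have "\<dots> = (\<Sum>k<b * d. A $$ (i div c, k div d) * B $$ (i mod c, k mod d)
      * (C $$ (k div d, j div f) * D $$ (k mod d, j mod f)))"
    using i j by (intro sum.cong refl)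
      (simp add: index_kronecker_mat[OF A B] index_kronecker_mat[OF C D])
  also have "\<dots> = (\<Sum>x<b. \<Sum>y<d. A $$ (i div c, x) * B $$ (i mod c, y)
      * (C $$ (x, j div f) * D $$ (y, j mod f)))"
    by (rule sum_lessThan_mult_div_mod)
  also have "\<dots> = (\<Sum>x<b. A $$ (i div c, x) * C $$ (x, j div f))
      * (\<Sum>y<d. B $$ (i mod c, y) * D $$ (y, j mod f))"
    by (simp add: sum_product ac_simps)
  also have "\<dots> = (A * C) $$ (i div c, j div f) * (B * D) $$ (i mod c, j mod f)"
    using assms im jm by (simp add: scalar_prod_def atLeast0LessThan)
  also have "\<dots> = ((A * C) \<otimes>\<^sub>K (B * D)) $$ (i, j)"
    using index_kronecker_mat[OF l(3,4) i j] by simp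
  finally show "((A \<otimes>\<^sub>K B) * (C \<otimes>\<^sub>K D)) $$ (i, j) = ((A * C) \<otimes>\<^sub>K (B * D)) $$ (i, j)" .
qed

lemma div_mod_eq_iff:
  fixes i j :: nat
  shows "i div n = j div n \<and> i mod n = j mod n \<longleftrightarrow> i = j"
  by (metis div_mod_decomp)

lemma kronecker_one_mat: "1\<^sub>m s \<otimes>\<^sub>K 1\<^sub>m n = (1\<^sub>m (s * n) :: 'a::semiring_1 mat)"
proof (rule eq_matI)
  fix i j assume "i < dim_row (1\<^sub>m (s * n) :: 'a mat)" "j < dim_col (1\<^sub>m (s * n) :: 'a mat)"
  then have ij: "i < s * n" "j < s * n" by auto
  show "(1\<^sub>m s \<otimes>\<^sub>K 1\<^sub>m n) $$ (i, j) = (1\<^sub>m (s * n) :: 'a mat) $$ (i, j)"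
    using div_mod_eq_iff[of i n j] ij div_mod_less_mult[OF ij(1)] div_mod_less_mult[OF ij(2)]
    by (auto simp: index_kronecker_mat[OF one_carrier_mat one_carrier_mat])
qed (auto simp: kronecker_mat_def)

text \<open>By the mixed-product rule both sides equal \<open>B \<otimes>\<^sub>K M\<close>.\<close>

lemma kronecker_intertwine:
  fixes B M :: "'a::comm_semiring_1 mat"
  assumes "B \<in> carrier_mat s s" "M \<in> carrier_mat n m"
  shows "(B \<otimes>\<^sub>K 1\<^sub>m n) * (1\<^sub>m s \<otimes>\<^sub>K M) = (1\<^sub>m s \<otimes>\<^sub>K M) * (B \<otimes>\<^sub>K 1\<^sub>m m)"
  using kronecker_mat_mult[OF assms(1) one_carrier_mat one_carrier_mat assms(2)]
    kronecker_mat_mult[OF one_carrier_mat assms(2) assms(1) one_carrier_mat] assms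
  by simp

section \<open>Block diagonality as commutation\<close>

text \<open>Induction on the list: stripping the first block lowers an index beyond it by
  \<open>N\<close>, hence its quotient by one, and keeps its remainder.\<close>

lemma diag_block_mat_uniform:
  assumes "set Ys \<subseteq> carrier_mat N N"
  shows "diag_block_mat Ys = mat (length Ys * N) (length Ys * N)
    (\<lambda>(i, j). if i div N = j div N then (Ys ! (i div N)) $$ (i mod N, j mod N) else 0)"
  using assms
proof (induction Ys)
  case Nil
  then show ?case by auto
next
  case (Cons Y Ys)
  then have Y: "Y \<in> carrier_mat N N" by simp
  show ?case
  proof (rule eq_matI)
    fix i j
    assume "i < dim_row (mat (length (Y # Ys) * N) (length (Y # Ys) * N) (\<lambda>(i, j).
        if i div N = j div N then ((Y # Ys) ! (i div N)) $$ (i mod N, j mod N) else 0))"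
      and "j < dim_col (mat (length (Y # Ys) * N) (length (Y # Ys) * N) (\<lambda>(i, j).
        if i div N = j div N then ((Y # Ys) ! (i div N)) $$ (i mod N, j mod N) else 0))"
    then have ij: "i < N + length Ys * N" "j < N + length Ys * N" by auto
    \<comment> \<open>For \<open>N = 0\<close> there are no indices; lowering a quotient by one
      requires a positive divisor.\<close>
    then have N: "N > 0" by (cases N) auto
    show "diag_block_mat (Y # Ys) $$ (i, j) = mat (length (Y # Ys) * N) (length (Y # Ys) * N)
        (\<lambda>(i, j). if i div N = j div N then ((Y # Ys) ! (i div N)) $$ (i mod N, j mod N)
          else 0) $$ (i, j)"
      using ij Y Cons N
      by (auto simp: Let_def le_div_geq le_mod_geq not_less div_less)
  qed (use Y Cons in \<open>auto simp: Let_def\<close>)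
qed

text \<open>For the converse direction the diagonal N x N blocks of \<open>Y\<close> are cut out as
  witnesses.\<close>

lemma ex_diag_block_mat_iff:
  assumes Y: "Y \<in> carrier_mat (s * N) (s * N)"
  shows "(\<exists>Ys. length Ys = s \<and> set Ys \<subseteq> carrier_mat N N \<and> Y = diag_block_mat Ys) \<longleftrightarrow>
    (\<forall>i<s * N. \<forall>j<s * N. i div N \<noteq> j div N \<longrightarrow> Y $$ (i, j) = 0)"
proof
  assume "\<exists>Ys. length Ys = s \<and> set Ys \<subseteq> carrier_mat N N \<and> Y = diag_block_mat Ys"
  then show "\<forall>i<s * N. \<forall>j<s * N. i div N \<noteq> j div N \<longrightarrow> Y $$ (i, j) = 0"
    by (auto simp: diag_block_mat_uniform)
next
  assume zero: "\<forall>i<s * N. \<forall>j<s * N. i div N \<noteq> j div N \<longrightarrow> Y $$ (i, j) = 0"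
  define Ys where "Ys = map (\<lambda>k. mat N N (\<lambda>(i, j). Y $$ (k * N + i, k * N + j))) [0..<s]"
  have Ys: "length Ys = s" "set Ys \<subseteq> carrier_mat N N" by (auto simp: Ys_def)
  have "Y = diag_block_mat Ys"
  proof (rule eq_matI)
    fix i j assume "i < dim_row (diag_block_mat Ys)" "j < dim_col (diag_block_mat Ys)"
    then have ij: "i < s * N" "j < s * N" by (auto simp: diag_block_mat_uniform[OF Ys(2)] Ys(1))
    have "j div N * N + j mod N = j" "i div N * N + i mod N = i" by auto
    then have "(Ys ! (i div N)) $$ (i mod N, j mod N) = Y $$ (i, j)" if "i div N = j div N"
      using that div_mod_less_mult[OF ij(1)] div_mod_less_mult[OF ij(2)]
      by (metis (no_types, lifting) Ys_def Ys(1) add_0 case_prod_conv index_mat(1) length_map nth_map nth_upt)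
    then show "Y $$ (i, j) = diag_block_mat Ys $$ (i, j)"
      using ij zero by (auto simp: diag_block_mat_uniform[OF Ys(2)] Ys(1))
  qed (use Y Ys in \<open>auto simp: diag_block_mat_uniform\<close>)
  with Ys show "\<exists>Ys. length Ys = s \<and> set Ys \<subseteq> carrier_mat N N \<and> Y = diag_block_mat Ys" by blast
qed

definition index_diag :: "nat \<Rightarrow> complex mat" where
  "index_diag s = mat s s (\<lambda>(i, j). if i = j then of_nat i else 0)"

lemma index_diag_carrier [simp]: "index_diag s \<in> carrier_mat s s"
  by (simp add: index_diag_def)

lemma kronecker_index_diag:
  "index_diag s \<otimes>\<^sub>K 1\<^sub>m N =
    mat (s * N) (s * N) (\<lambda>(i, j). if i = j then of_nat (i div N) else 0)" (is "_ = ?M")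
proof (rule eq_matI)
  fix i j assume "i < dim_row ?M" "j < dim_col ?M"
  then have ij: "i < s * N" "j < s * N" by auto
  show "(index_diag s \<otimes>\<^sub>K 1\<^sub>m N) $$ (i, j) = ?M $$ (i, j)"
    using div_mod_eq_iff[of i N j] ij div_mod_less_mult[OF ij(1)] div_mod_less_mult[OF ij(2)]
    by (auto simp: index_kronecker_mat[OF index_diag_carrier one_carrier_mat])
      (auto simp: index_diag_def)
qed (auto simp: kronecker_mat_def index_diag_def)

text \<open>Entry (i, j) of \<open>Y\<close> is multiplied by \<open>i div N\<close> on one side and
  by \<open>j div N\<close> on the other. As complex numbers these differ exactly when i and j lie
  in different blocks, and then the entry must vanish.\<close>

lemma commute_index_diag_iff:
  assumes Y: "Y \<in> carrier_mat (s * N) (s * N)"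
  shows "(index_diag s \<otimes>\<^sub>K 1\<^sub>m N) * Y = Y * (index_diag s \<otimes>\<^sub>K 1\<^sub>m N) \<longleftrightarrow>
    (\<forall>i<s * N. \<forall>j<s * N. i div N \<noteq> j div N \<longrightarrow> Y $$ (i, j) = 0)"
proof -
  \<comment> \<open>One factor is diagonal, so a single term of the inner sum survives.\<close>
  have l: "((index_diag s \<otimes>\<^sub>K 1\<^sub>m N) * Y) $$ (i, j) = of_nat (i div N) * Y $$ (i, j)"
    and r: "(Y * (index_diag s \<otimes>\<^sub>K 1\<^sub>m N)) $$ (i, j) = Y $$ (i, j) * of_nat (j div N)"
    if "i < s * N" "j < s * N" for i j
    using that Y
    by (auto simp: kronecker_index_diag scalar_prod_def if_distrib[of "\<lambda>x. x * _"]
        if_distrib[of "\<lambda>x. _ * x"] cong: if_cong)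
  have "(index_diag s \<otimes>\<^sub>K 1\<^sub>m N) * Y = Y * (index_diag s \<otimes>\<^sub>K 1\<^sub>m N) \<longleftrightarrow>
    (\<forall>i<s * N. \<forall>j<s * N. ((index_diag s \<otimes>\<^sub>K 1\<^sub>m N) * Y) $$ (i, j)
      = (Y * (index_diag s \<otimes>\<^sub>K 1\<^sub>m N)) $$ (i, j))"
    using Y by (subst mat_eq_iff) (auto simp: kronecker_index_diag)
  also have "\<dots> \<longleftrightarrow> (\<forall>i<s * N. \<forall>j<s * N. i div N \<noteq> j div N \<longrightarrow> Y $$ (i, j) = 0)"
    by (auto simp: l r)
  finally show ?thesis .
qed

text \<open>Conjugation by \<open>X \<otimes>\<^sub>K 1\<^sub>m N\<close> carries the commutation
  criterion for block diagonality over to \<open>Y\<close>. The matrix \<open>B\<close> does not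
  involve \<open>N\<close>, so the same \<open>B\<close> can be paired with an identity of any local
  size.\<close>

lemma monolithic_iff_commute:
  assumes X: "X \<in> carrier_mat s s" and inv: "invertible_mat X"
    and Y: "Y \<in> carrier_mat (s * N) (s * N)"
  defines "B \<equiv> X * index_diag s * mat_inv X"
  shows "monolithic s N X Y \<longleftrightarrow> (B \<otimes>\<^sub>K 1\<^sub>m N) * Y = Y * (B \<otimes>\<^sub>K 1\<^sub>m N)"
proof -
  note X' = mat_inv_properties[OF X inv]
  let ?P = "X \<otimes>\<^sub>K 1\<^sub>m N" and ?Q = "mat_inv X \<otimes>\<^sub>K 1\<^sub>m N" and ?E = "index_diag s \<otimes>\<^sub>K 1\<^sub>m N"
  have car: "?P \<in> carrier_mat (s * N) (s * N)" "?Q \<in> carrier_mat (s * N) (s * N)"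
    "?E \<in> carrier_mat (s * N) (s * N)"
    using X X' by auto
  have PQ: "?P * ?Q = 1\<^sub>m (s * N)" and QP: "?Q * ?P = 1\<^sub>m (s * N)"
    using X X' by (auto simp: kronecker_mat_mult[of _ s s _ N N _ s _ N] kronecker_one_mat)
  have "?P * ?E * ?Q = B \<otimes>\<^sub>K 1\<^sub>m N"
    using X X' mult_carrier_mat[OF X index_diag_carrier]
    by (simp add: B_def kronecker_mat_mult[of _ s s _ N N _ s _ N])
  moreover have "?Q * Y * ?P \<in> carrier_mat (s * N) (s * N)"
    using car Y by (simp add: mult_carrier_mat[of _ "s * N" "s * N"])
  \<comment> \<open>This identifies the inverse that occurs in the definition of
    \<open>monolithic\<close>.\<close>
  moreover have "mat_inv ?P = ?Q" using car PQ QP by (intro mat_inv_eqI)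
  ultimately show ?thesis
    using commute_conjugate_iff[OF car(3,1,2) Y PQ QP] Y
    by (simp add: monolithic_def ex_diag_block_mat_iff commute_index_diag_iff)
qed

section \<open>Sums and the terms of the Schwarz preconditioner\<close>

text \<open>Induction on \<open>I\<close> by distributivity. Membership in the carrier is proved
  along with commutation, since the distributive laws need the dimensions of the partial
  sum.\<close>

lemma commute_finsum_mat:
  fixes A :: "'a::comm_ring_1 mat"
  assumes "finite I" and A: "A \<in> carrier_mat n n"
    and "\<And>i. i \<in> I \<Longrightarrow> M i \<in> carrier_mat n n" and "\<And>i. i \<in> I \<Longrightarrow> A * M i = M i * A"
  defines "S \<equiv> finsum (module_mat TYPE('a) n n) M I"
  shows "S \<in> carrier_mat n n" "A * S = S * A"
proof -
  interpret abelian_group "module_mat TYPE('a) n n" by (rule abelian_group_mat)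
  have "finsum (module_mat TYPE('a) n n) M I \<in> carrier_mat n n \<and>
    A * finsum (module_mat TYPE('a) n n) M I = finsum (module_mat TYPE('a) n n) M I * A"
    using assms(1,3,4)
  proof (induction I)
    case empty
    then show ?case using A by (simp add: module_mat_simps)
  next
    case (insert i I)
    then have "finsum (module_mat TYPE('a) n n) M (insert i I)
        = M i + finsum (module_mat TYPE('a) n n) M I"
      by (subst finsum_insert) (auto simp: module_mat_simps)
    then show ?case
      using insert A by (auto simp: add_mult_distrib_mat[of _ n n _ _ n]
          mult_add_distrib_mat[of _ n n _ n])
  qed
  then show "S \<in> carrier_mat n n" "A * S = S * A" by (auto simp: S_def)
qed

lemma (in vector_space) length_ordered_basis:
  assumes "ordered_basis bs V"
  shows "length bs = dim V"
  using assms dim_eq_card[of "set bs" V] distinct_card[of bs]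
  by (auto simp: ordered_basis_def span_span)

text \<open>The chain \<open>R\<close>, \<open>C\<close>, \<open>P\<close> passes through the sizes
  n, N, N, n, so the local matrix and its inverse commute with
  \<open>B \<otimes>\<^sub>K 1\<^sub>m n\<close>. The outer prolongation and restriction lead back
  to size N.\<close>

lemma schwarz_term_commute:
  fixes B C P R :: "complex mat"
  assumes B: "B \<in> carrier_mat s s" and C: "C \<in> carrier_mat (s * N) (s * N)"
    and P: "P \<in> carrier_mat N n" and R: "R \<in> carrier_mat n N"
    and inv: "invertible_mat (local_mat s C P R)"
    and comm: "(B \<otimes>\<^sub>K 1\<^sub>m N) * C = C * (B \<otimes>\<^sub>K 1\<^sub>m N)"
  defines "T \<equiv> (1\<^sub>m s \<otimes>\<^sub>K P) * mat_inv (local_mat s C P R) * (1\<^sub>m s \<otimes>\<^sub>K R)"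
  shows "T \<in> carrier_mat (s * N) (s * N)" "(B \<otimes>\<^sub>K 1\<^sub>m N) * T = T * (B \<otimes>\<^sub>K 1\<^sub>m N)"
proof -
  let ?P = "1\<^sub>m s \<otimes>\<^sub>K P" and ?R = "1\<^sub>m s \<otimes>\<^sub>K R" and ?L = "local_mat s C P R"
  have P': "?P \<in> carrier_mat (s * N) (s * n)" and R': "?R \<in> carrier_mat (s * n) (s * N)"
    and BN: "B \<otimes>\<^sub>K 1\<^sub>m N \<in> carrier_mat (s * N) (s * N)"
    and Bn: "B \<otimes>\<^sub>K 1\<^sub>m n \<in> carrier_mat (s * n) (s * n)"
    using B P R by auto
  note RC = mult_carrier_mat[OF R' C]
  have L: "?L \<in> carrier_mat (s * n) (s * n)"
    unfolding local_mat_def by (rule mult_carrier_mat[OF RC P'])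
  have "(B \<otimes>\<^sub>K 1\<^sub>m n) * ?L = ?L * (B \<otimes>\<^sub>K 1\<^sub>m n)"
    unfolding local_mat_def
    by (intro intertwine_mult[OF Bn BN Bn RC P'] intertwine_mult[OF Bn BN BN R' C]
        kronecker_intertwine[OF B] P R comm)
  note L' = commute_mat_inv[OF Bn L inv this] and Lc = mat_inv_properties(3)[OF L inv]
  note PL = mult_carrier_mat[OF P' Lc]
  show "T \<in> carrier_mat (s * N) (s * N)"
    unfolding T_def by (rule mult_carrier_mat[OF PL R'])
  show "(B \<otimes>\<^sub>K 1\<^sub>m N) * T = T * (B \<otimes>\<^sub>K 1\<^sub>m N)"
    unfolding T_def
    by (intro intertwine_mult[OF BN Bn BN PL R'] intertwine_mult[OF BN Bn Bn P' Lc]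
        kronecker_intertwine[OF B] P R L')
qed

theorem theorem3p9:
  fixes \<phi> :: "'k::field \<Rightarrow> complex"
    and scale :: "'k \<Rightarrow> 'v::ab_group_add \<Rightarrow> 'v"
    and s N NS :: nat
    and n :: "nat \<Rightarrow> nat"
    and A :: "real mat"
    and X \<Lambda> C W :: "complex mat"
    and Vh :: "'v set" and bh :: "'v list"
    and V :: "nat \<Rightarrow> 'v set" and b :: "nat \<Rightarrow> 'v list"
    and P R :: "nat \<Rightarrow> complex mat"
  assumes "A \<in> carrier_mat s s"
    and "X \<in> carrier_mat s s" and "invertible_mat X"
    and "\<Lambda> \<in> carrier_mat s s" and "diagonal_mat \<Lambda>"
    and "map_mat complex_of_real A = X * \<Lambda> * mat_inv X"
    and "field_hom \<phi>" and "vector_space scale"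
    and "vector_space.ordered_basis scale bh Vh" and "vector_space.dim scale Vh = N"
    and "\<And>i. i < NS \<Longrightarrow> vector_space.ordered_basis scale (b i) (V i)"
    and "\<And>i. i < NS \<Longrightarrow> vector_space.dim scale (V i) = n i"
    and "Vh = {\<Sum>i<NS. v i | v. \<forall>i<NS. v i \<in> V i}"
    and "\<And>i. i < NS \<Longrightarrow> P i = map_mat \<phi> (vector_space.inclusion_mat scale bh (b i))"
    and "\<And>i. i < NS \<Longrightarrow> R i \<in> carrier_mat (n i) N"
    and "C \<in> carrier_mat (s * N) (s * N)" and "invertible_mat C"
    and "\<And>i. i < NS \<Longrightarrow> invertible_mat (local_mat s C (P i) (R i))"
    and "invertible_mat (schwarz_sum s N NS C P R)"
    and "W \<in> carrier_mat (s * N) (s * N)" and "invertible_mat W"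
    and "mat_inv W = schwarz_sum s N NS C P R"
    and "monolithic s N X C"
  shows "monolithic s N X W"
proof -
  interpret vector_space scale by fact
  note X = assms(2,3) and C = assms(16) and W = assms(20,21)
  define B where "B = X * index_diag s * mat_inv X"
  let ?B = "B \<otimes>\<^sub>K 1\<^sub>m N"
  have B: "B \<in> carrier_mat s s"
    using X mat_inv_properties(3)[OF X] unfolding B_def
    by (intro mult_carrier_mat[of _ s s] index_diag_carrier)
  have BN: "?B \<in> carrier_mat (s * N) (s * N)" using B by simp
  have comm: "?B * C = C * ?B"
    using assms(23) monolithic_iff_commute[OF X C] by (simp add: B_def)
  \<comment> \<open>The inclusion matrix has the lengths of the two bases as dimensions, which are
    the dimensions of the spaces; applying \<open>\<phi>\<close> entrywise preserves them.\<close>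
  have P: "P i \<in> carrier_mat N (n i)" if "i < NS" for i
    using assms(14)[OF that] length_ordered_basis[OF assms(9)] assms(10)
      length_ordered_basis[OF assms(11)[OF that]] assms(12)[OF that]
    by (simp add: inclusion_mat_def)
  note T = schwarz_term_commute[OF B C P assms(15,18) comm]
  have "?B * schwarz_sum s N NS C P R = schwarz_sum s N NS C P R * ?B"
    unfolding schwarz_sum_def by (rule commute_finsum_mat(2)[OF _ BN]) (auto intro: T)
  then have S: "?B * mat_inv W = mat_inv W * ?B" using assms(22) by simp
  have "?B * W = W * ?B"
    \<comment> \<open>The roles are swapped here: \<open>mat_inv W\<close> is the commuting matrix
      and \<open>W\<close> is its inverse.\<close>
    by (rule commute_inverse[OF BN _ W(1) _ _ S]) (use mat_inv_properties[OF W] in auto)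
  then show ?thesis
    using monolithic_iff_commute[OF X W(1)] by (simp add: B_def)
qed

end
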